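(* Let $T_n$ be an Eulerian tournament on $n$ vertices. Then $$\mathrm{arb}(T_n)\leq \frac{1}{n}\left(\frac{n(n+1)}{4}\right)^{\frac{n-1}{2}},$$ with equality if and only if $T_n$ is a Hadamard tournament.
   Context: A tournament on $n$ vertices is an orientation of the complete graph $K_n$; it is Eulerian if every vertex has equal in-degree and out-degree. An arborescence of a directed graph $D$ rooted at a vertex $v$ is a spanning tree of $D$ in which every vertex different from $v$ has out-degree $1$ and $v$ has out-degree $0$ (every edge is oriented towards the root). $\mathrm{arb}(D,v)$ is the number of arborescences of $D$ rooted at $v$; for an Eulerian digraph $D$ it does not depend on $v$ and is denoted $\mathrm{arb}(D)$. The adjacency matrix $A$ of a tournament has $A_{ij}=1$ if there is an edge directed from $v_i$ to $v_j$ and $A_{ij}=0$ otherwise. A tournament on $n$ vertices is a Hadamard tournament if its adjacency matrix satisfies $AA^T=\frac{n+1}{4}I+\frac{n-3}{4}J$, where $I$ is the $n\times n$ identity matrix and $J$ is the $n\times n$ all-ones matrix. *)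

theory Defs
  imports "Graph_Theory.Graph_Theory" "Jordan_Normal_Form.Matrix"
begin

section \<open>Tournaments\<close>

definition tournament :: "('a, 'b) pre_digraph \<Rightarrow> bool" where
  "tournament G \<longleftrightarrow> digraph G \<and>
     (\<forall>u \<in> verts G. \<forall>w \<in> verts G. u \<noteq> w \<longrightarrow>
        ((u, w) \<in> arcs_ends G \<longleftrightarrow> (w, u) \<notin> arcs_ends G))"

definition eulerian :: "('a, 'b) pre_digraph \<Rightarrow> bool" where
  "eulerian G \<longleftrightarrow> (\<forall>u \<in> verts G. in_degree G u = out_degree G u)"

section \<open>Arborescences\<close>

text \<open>
  The library predicate \<^const>\<open>forest\<close> (hence \<^const>\<open>tree\<close> and \<^const>\<open>spanning_tree\<close>) only
  forbids directed cycles, so a transitive tournament would count as a tree. Here the underlying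
  undirected graph has to be acyclic. In \<^const>\<open>mk_symmetric\<close> every edge \<open>{a, b}\<close> yields the
  cycle \<open>a, b, a\<close>, so that undirected cycles are the cycles of length at least \<open>3\<close>; loops and
  pairs of antiparallel arcs are excluded by \<^const>\<open>forest\<close>.
\<close>

definition undirected_forest :: "('a, 'b) pre_digraph \<Rightarrow> bool" where
  "undirected_forest H \<longleftrightarrow> forest H \<and>
     \<not> (\<exists>p. pre_digraph.cycle (with_proj (mk_symmetric H)) p \<and> length p \<ge> 3)"

text \<open>The predicate \<^const>\<open>connected\<close> is weak connectivity.\<close>

definition undirected_spanning_tree :: "('a, 'b) pre_digraph \<Rightarrow> ('a, 'b) pre_digraph \<Rightarrow> bool" where
  "undirected_spanning_tree H G \<longleftrightarrow> spanning H G \<and> connected H \<and> undirected_forest H"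

definition arborescence :: "('a, 'b) pre_digraph \<Rightarrow> 'a \<Rightarrow> ('a, 'b) pre_digraph \<Rightarrow> bool" where
  "arborescence G v H \<longleftrightarrow> undirected_spanning_tree H G \<and> v \<in> verts G \<and>
     out_degree H v = 0 \<and> (\<forall>u \<in> verts G - {v}. out_degree H u = 1)"

definition arb :: "('a, 'b) pre_digraph \<Rightarrow> 'a \<Rightarrow> nat" where
  "arb G v = card {H. arborescence G v H}"

section \<open>Hadamard tournaments\<close>

definition adjacency_matrix :: "('a, 'b) pre_digraph \<Rightarrow> 'a list \<Rightarrow> real mat" where
  "adjacency_matrix G vs = mat (length vs) (length vs)
     (\<lambda>(i, j). if (vs ! i, vs ! j) \<in> arcs_ends G then 1 else 0)"

definition hadamard_matrix_equation :: "nat \<Rightarrow> real mat \<Rightarrow> bool" where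
  "hadamard_matrix_equation n A \<longleftrightarrow>
     A * transpose_mat A =
       ((real n + 1) / 4) \<cdot>\<^sub>m 1\<^sub>m n + ((real n - 3) / 4) \<cdot>\<^sub>m mat n n (\<lambda>_. 1)"

text \<open>
  The list \<open>vs\<close> is an enumeration of the vertices. The choice is immaterial, see
  \<open>hadamard_tournament_iff\<close> below.
\<close>

definition hadamard_tournament :: "('a, 'b) pre_digraph \<Rightarrow> bool" where
  "hadamard_tournament G \<longleftrightarrow> tournament G \<and>
     (\<exists>vs. distinct vs \<and> set vs = verts G \<and>
        hadamard_matrix_equation (card (verts G)) (adjacency_matrix G vs))"

lemma hadamard_matrix_equation_adjacency_matrix_iff:
  assumes "distinct vs" "set vs = verts G"
  shows "hadamard_matrix_equation (card (verts G)) (adjacency_matrix G vs) \<longleftrightarrow>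
    (\<forall>u \<in> verts G. \<forall>w \<in> verts G.
       real (card {x \<in> verts G. (u, x) \<in> arcs_ends G \<and> (w, x) \<in> arcs_ends G}) =
         (if u = w then (real (card (verts G)) + 1) / 4 else 0) + (real (card (verts G)) - 3) / 4)"
proof -
  define n where "n = length vs"
  have n: "card (verts G) = n"
    using assms distinct_card[of vs] by (simp add: n_def)
  have entry: "(adjacency_matrix G vs * transpose_mat (adjacency_matrix G vs)) $$ (i, j) =
      real (card {x \<in> verts G. (vs ! i, x) \<in> arcs_ends G \<and> (vs ! j, x) \<in> arcs_ends G})"
    if "i < n" "j < n" for i j
  proof -
    have "(adjacency_matrix G vs * transpose_mat (adjacency_matrix G vs)) $$ (i, j) =
        (\<Sum>k<n. if (vs ! i, vs ! k) \<in> arcs_ends G \<and> (vs ! j, vs ! k) \<in> arcs_ends G then 1 else 0)"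
      using that
      by (auto simp: adjacency_matrix_def scalar_prod_def n_def atLeast0LessThan intro!: sum.cong)
    also have "\<dots> =
        (\<Sum>x\<in>verts G. if (vs ! i, x) \<in> arcs_ends G \<and> (vs ! j, x) \<in> arcs_ends G then 1 else 0)"
      using sum.reindex_bij_betw[OF bij_betw_nth[OF assms(1) refl refl],
        of "\<lambda>x. if (vs ! i, x) \<in> arcs_ends G \<and> (vs ! j, x) \<in> arcs_ends G then 1 else 0 :: real"] assms(2)
      by (simp add: n_def)
    also have "\<dots> =
        real (card {x \<in> verts G. (vs ! i, x) \<in> arcs_ends G \<and> (vs ! j, x) \<in> arcs_ends G})"
      using assms(2) by (simp add: sum.If_cases Int_def flip: assms(2))
    finally show ?thesis .
  qed
  have dims: "dim_row (adjacency_matrix G vs) = n"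
    by (simp add: adjacency_matrix_def n_def)
  have "hadamard_matrix_equation (card (verts G)) (adjacency_matrix G vs) \<longleftrightarrow>
    (\<forall>i<n. \<forall>j<n. (adjacency_matrix G vs * transpose_mat (adjacency_matrix G vs)) $$ (i, j) =
      (if i = j then (real n + 1) / 4 else 0) + (real n - 3) / 4)"
    unfolding hadamard_matrix_equation_def mat_eq_iff n
    by (auto simp: dims simp del: index_mult_mat(1))
  also have "\<dots> \<longleftrightarrow>
    (\<forall>i<n. \<forall>j<n. real (card {x \<in> verts G. (vs ! i, x) \<in> arcs_ends G \<and> (vs ! j, x) \<in> arcs_ends G}) =
      (if i = j then (real n + 1) / 4 else 0) + (real n - 3) / 4)"
    by (simp add: entry del: index_mult_mat(1) cong: conj_cong)
  also have "\<dots> \<longleftrightarrow> (\<forall>u \<in> set vs. \<forall>w \<in> set vs.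
       real (card {x \<in> verts G. (u, x) \<in> arcs_ends G \<and> (w, x) \<in> arcs_ends G}) =
         (if u = w then (real n + 1) / 4 else 0) + (real n - 3) / 4)"
    using assms(1) by (simp add: all_set_conv_all_nth n_def nth_eq_iff_index_eq)
  finally show ?thesis
    by (simp add: n assms(2))
qed

lemma hadamard_tournament_iff:
  assumes "distinct vs" "set vs = verts G"
  shows "hadamard_tournament G \<longleftrightarrow>
    tournament G \<and> hadamard_matrix_equation (card (verts G)) (adjacency_matrix G vs)"
  unfolding hadamard_tournament_def
  using assms hadamard_matrix_equation_adjacency_matrix_iff by blast

end

theory Submission
  imports Defs "Jordan_Normal_Form.Determinant"
begin

text \<open>
  Let \<open>A\<close> be the adjacency matrix of the Eulerian tournament, \<open>L = (n - 1) / 2 I - A\<close> its Laplacian, and \<open>J\<close> the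
  all-ones matrix. The rows and the columns of \<open>L\<close> sum to zero. The matrix tree theorem (\<open>matrix_tree\<close> together
  with \<open>arb_eq_card_functions\<close>) says that the number \<open>arb\<close> of arborescences is a principal minor of \<open>L\<close> of
  order \<open>n - 1\<close>, and row and column operations (\<open>det_add_const_zero_sums\<close>) give \<open>det (L + c J) = c n\<^sup>2 arb\<close>
  for every real \<open>c\<close>.

  The bound is Hadamard's inequality \<open>(det X)\<^sup>2 \<le> \<Prod>\<^sub>i \<parallel>x\<^sub>i\<parallel>\<^sup>2\<close> for the rows of \<open>X = L + c J\<close>, taken at
  \<open>c\<^sup>2 = (n + 1) / (4 n)\<close>. All rows then have the squared length \<open>q = n (n + 1) / 4\<close>, and
  \<open>(det X)\<^sup>2 = c\<^sup>2 n\<^sup>4 arb\<^sup>2 = q (n arb)\<^sup>2\<close>, so the inequality becomes \<open>(n arb)\<^sup>2 \<le> q ^ (n - 1)\<close>. With this \<open>c\<close> the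
  eigenvalue of \<open>X X\<^sup>T\<close> on the all-ones vector equals \<open>q\<close> as well, as it must if the rows are to be orthogonal. Equality in Hadamard's inequality
  means orthogonality of the rows (\<open>orthogonal_if_det_gram_eq_prod\<close>), that is \<open>X X\<^sup>T = q I\<close>. Because of
  \<open>A + A\<^sup>T = J - I\<close> this is the equation \<open>A A\<^sup>T = (n + 1) / 4 I + (n - 3) / 4 J\<close>.

  The matrix tree theorem is proved by expanding the determinant into a sum over all choices of one
  out-neighbour for each vertex other than the root. The summand of a choice is \<open>1\<close> if following the chosen arcs leads from
  every vertex to the root, and \<open>0\<close> otherwise. The former choices correspond to the arborescences.
\<close>

section \<open>Determinants of matrices given by functions\<close>

lemma det_first_column:
  fixes f :: "nat \<Rightarrow> nat \<Rightarrow> 'a :: comm_ring_1"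
  assumes "\<And>i. 0 < i \<Longrightarrow> i < Suc n \<Longrightarrow> f i 0 = 0"
  shows "det (mat (Suc n) (Suc n) (\<lambda>(i, j). f i j)) = f 0 0 * det (mat n n (\<lambda>(i, j). f (Suc i) (Suc j)))"
proof -
  let ?A = "mat (Suc n) (Suc n) (\<lambda>(i, j). f i j)"
  have "mat_delete ?A 0 0 = mat n n (\<lambda>(i, j). f (Suc i) (Suc j))"
    by (rule eq_matI) (auto simp: mat_delete_def)
  moreover have "det ?A = (\<Sum>i<Suc n. ?A $$ (i, 0) * cofactor ?A i 0)"
    by (rule laplace_expansion_column) auto
  moreover have "\<dots> = (\<Sum>i\<in>{0}. ?A $$ (i, 0) * cofactor ?A i 0)"
    by (rule sum.mono_neutral_right) (auto simp: assms)
  ultimately show ?thesis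
    by (simp add: cofactor_def)
qed

lemma det_lower_unitriangular:
  fixes f :: "nat \<Rightarrow> nat \<Rightarrow> 'a :: comm_ring_1"
  assumes "\<And>i j. i < j \<Longrightarrow> j < n \<Longrightarrow> f i j = 0" "\<And>i. i < n \<Longrightarrow> f i i = 1"
  shows "det (mat n n (\<lambda>(i, j). f i j)) = 1"
proof -
  have "det (mat n n (\<lambda>(i, j). f i j)) = prod_list (diag_mat (mat n n (\<lambda>(i, j). f i j)))"
    by (rule det_lower_triangular[of n]) (auto simp: assms(1))
  then show ?thesis
    by (simp add: prod_list_diag_prod assms(2))
qed

lemma det_times_fun:
  fixes f g :: "nat \<Rightarrow> nat \<Rightarrow> 'a :: comm_ring_1"
  shows "det (mat n n (\<lambda>(i, j). f i j)) * det (mat n n (\<lambda>(i, j). g i j)) =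
    det (mat n n (\<lambda>(i, j). \<Sum>k<n. f i k * g k j))"
proof -
  have "mat n n (\<lambda>(i, j). f i j) * mat n n (\<lambda>(i, j). g i j) = mat n n (\<lambda>(i, j). \<Sum>k<n. f i k * g k j)"
    by (rule eq_matI) (auto simp: scalar_prod_def atLeast0LessThan)
  then show ?thesis
    by (metis det_mult mat_carrier)
qed

lemma det_mat_cong:
  assumes "\<And>i j. i < n \<Longrightarrow> j < n \<Longrightarrow> f i j = g i j"
  shows "det (mat n n (\<lambda>(i, j). f i j)) = det (mat n n (\<lambda>(i, j). g i j))"
  by (rule arg_cong[of _ _ det], rule eq_matI) (auto simp: assms)

text \<open>
  One round of Gaussian elimination. If the first pivot is nonzero, then
  \<open>t i = f (Suc i) 0 / f 0 0\<close> and the remaining matrix is the Schur complement of the pivot.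
\<close>

lemma det_clear_first_column:
  fixes f :: "nat \<Rightarrow> nat \<Rightarrow> 'a :: comm_ring_1"
  assumes "\<And>i. i < n \<Longrightarrow> f (Suc i) 0 = t i * f 0 0"
  shows "det (mat (Suc n) (Suc n) (\<lambda>(i, j). f i j)) =
    f 0 0 * det (mat n n (\<lambda>(i, j). f (Suc i) (Suc j) - t i * f 0 (Suc j)))"
proof -
  define e :: "nat \<Rightarrow> nat \<Rightarrow> 'a" where
    "e i j = (if i = j then 1 else if j = 0 then - t (i - 1) else 0)" for i j
  have E: "(\<Sum>k<Suc n. e i k * f k j) = (if i = 0 then f 0 j else f i j - t (i - 1) * f 0 j)"
    if "i < Suc n" for i j
  proof -
    have "(\<Sum>k<Suc n. e i k * f k j) = e i 0 * f 0 j + (\<Sum>k<n. e i (Suc k) * f (Suc k) j)"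
      by (rule sum.lessThan_Suc_shift)
    also have "(\<Sum>k<n. e i (Suc k) * f (Suc k) j) = (\<Sum>k<n. if k = i - 1 then (if i = 0 then 0 else f i j) else 0)"
      by (rule sum.cong) (auto simp: e_def)
    also have "\<dots> = (if i = 0 then 0 else f i j)"
      using that by (subst sum.delta) auto
    finally show ?thesis
      by (auto simp: e_def)
  qed
  have "det (mat (Suc n) (Suc n) (\<lambda>(i, j). f i j)) =
      det (mat (Suc n) (Suc n) (\<lambda>(i, j). e i j)) * det (mat (Suc n) (Suc n) (\<lambda>(i, j). f i j))"
    by (subst det_lower_unitriangular) (auto simp: e_def)
  also have "\<dots> = det (mat (Suc n) (Suc n) (\<lambda>(i, j). if i = 0 then f 0 j else f i j - t (i - 1) * f 0 j))"
    unfolding det_times_fun by (rule det_mat_cong) (rule E)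
  also have "\<dots> = f 0 0 * det (mat n n (\<lambda>(i, j). f (Suc i) (Suc j) - t i * f 0 (Suc j)))"
    by (subst det_first_column) (auto simp: assms gr0_conv_Suc)
  finally show ?thesis .
qed

text \<open>
  Adding all rows to row \<open>0\<close> and all columns to column \<open>0\<close> leaves \<open>L\<close> untouched outside of row and
  column \<open>0\<close> and annihilates it there. The constant \<open>c\<close> contributes \<open>c n\<^sup>2\<close> at the corner and \<open>c n\<close> in the
  rest of row and column \<open>0\<close>, where \<open>n = Suc m\<close>. Subtracting \<open>1 / n\<close> times row \<open>0\<close> from every other row then cancels the
  constant from the minor as well.
\<close>

lemma det_add_const_zero_sums:
  fixes L :: "nat \<Rightarrow> nat \<Rightarrow> real"
  assumes rows: "\<And>i. i < Suc m \<Longrightarrow> (\<Sum>j<Suc m. L i j) = 0"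
    and cols: "\<And>j. j < Suc m \<Longrightarrow> (\<Sum>i<Suc m. L i j) = 0"
  shows "det (mat (Suc m) (Suc m) (\<lambda>(i, j). L i j + c)) =
    c * (real (Suc m))\<^sup>2 * det (mat m m (\<lambda>(i, j). L (Suc i) (Suc j)))"
proof -
  let ?n = "Suc m"
  \<comment> \<open>Multiplication by \<open>P\<close> from the left adds all rows to row \<open>0\<close>; its transpose does the same for columns.\<close>
  define P :: "nat \<Rightarrow> nat \<Rightarrow> real" where "P i j = (if i = 0 \<or> i = j then 1 else 0)" for i j
  have P_row: "(\<Sum>k<?n. P i k * g k) = (if i = 0 then \<Sum>k<?n. g k else g i)" if "i < ?n" for i g
  proof (cases "i = 0")
    case False
    then have "(\<Sum>k<?n. P i k * g k) = (\<Sum>k<?n. if k = i then g i else 0)"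
      by (intro sum.cong) (auto simp: P_def)
    then show ?thesis
      using False that by (simp add: sum.delta del: sum.lessThan_Suc)
  qed (simp add: P_def)
  have transpose_P: "transpose_mat (mat ?n ?n (\<lambda>(i, j). P j i)) = mat ?n ?n (\<lambda>(i, j). P i j)"
    by (rule eq_matI) auto
  have detPT: "det (mat ?n ?n (\<lambda>(i, j). P j i)) = 1"
    by (rule det_lower_unitriangular) (auto simp: P_def)
  then have detP: "det (mat ?n ?n (\<lambda>(i, j). P i j)) = 1"
    using det_transpose[of "mat ?n ?n (\<lambda>(i, j). P j i)" ?n] transpose_P by simp
  have "det (mat ?n ?n (\<lambda>(i, j). P i j)) * det (mat ?n ?n (\<lambda>(i, j). L i j + c)) =
      det (mat ?n ?n (\<lambda>(i, j). if i = 0 then c * real ?n else L i j + c))"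
    unfolding det_times_fun
    by (rule det_mat_cong, subst P_row) (auto simp: sum.distrib cols simp del: sum.lessThan_Suc)
  then have "det (mat ?n ?n (\<lambda>(i, j). L i j + c)) =
      det (mat ?n ?n (\<lambda>(i, j). if i = 0 then c * real ?n else L i j + c)) * det (mat ?n ?n (\<lambda>(i, j). P j i))"
    by (simp add: detP detPT)
  also have "\<dots> = det (mat ?n ?n (\<lambda>(i, j). if i = 0 then if j = 0 then c * (real ?n)\<^sup>2 else c * real ?n
      else if j = 0 then c * real ?n else L i j + c))"
    unfolding det_times_fun
    by (rule det_mat_cong, subst mult.commute, subst P_row)
      (auto simp: sum.distrib rows power2_eq_square simp del: sum.lessThan_Suc)
  also have "\<dots> = c * (real ?n)\<^sup>2 * det (mat m m (\<lambda>(i, j). L (Suc i) (Suc j) + c - 1 / real ?n * (c * real ?n)))"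
    by (subst det_clear_first_column[where t = "\<lambda>_. 1 / real ?n"]) (auto simp: power2_eq_square)
  finally show ?thesis
    by simp
qed

section \<open>Hadamard's inequality\<close>

definition dot :: "nat \<Rightarrow> (nat \<Rightarrow> real) \<Rightarrow> (nat \<Rightarrow> real) \<Rightarrow> real" where
  "dot m y z = (\<Sum>k<m. y k * z k)"

text \<open>
  Hadamard's inequality for Gram determinants. If \<open>x 0\<close> is nonzero, then subtracting from the other vectors their
  projections on \<open>x 0\<close> keeps the determinant, splits off the factor \<open>\<parallel>x 0\<parallel>\<^sup>2\<close>, and shortens every vector
  that was not orthogonal to \<open>x 0\<close>. The induction therefore loses a strict factor exactly when some
  vector is not orthogonal to an earlier one, unless a vector vanishes. The three claims are stated together because
  the induction needs all of them.
\<close>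

lemma hadamard_gram:
  fixes x :: "nat \<Rightarrow> nat \<Rightarrow> real"
  shows "0 \<le> det (mat n n (\<lambda>(i, j). dot m (x i) (x j)))
    \<and> det (mat n n (\<lambda>(i, j). dot m (x i) (x j))) \<le> (\<Prod>i<n. dot m (x i) (x i))
    \<and> (det (mat n n (\<lambda>(i, j). dot m (x i) (x j))) = (\<Prod>i<n. dot m (x i) (x i)) \<longrightarrow> (\<forall>i<n. dot m (x i) (x i) \<noteq> 0)
       \<longrightarrow> (\<forall>i<n. \<forall>j<n. i \<noteq> j \<longrightarrow> dot m (x i) (x j) = 0))"
proof (induction n arbitrary: x)
  case 0
  show ?case by simp
next
  case (Suc n)
  have dot_commute: "dot m y z = dot m z y" for y z
    by (simp add: dot_def mult.commute)
  have dot_nonneg: "dot m y y \<ge> 0" for y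
    unfolding dot_def by (intro sum_nonneg) simp
  define g where "g = dot m (x 0) (x 0)"
  \<comment> \<open>\<open>y i\<close> is the component of \<open>x (Suc i)\<close> orthogonal to \<open>x 0\<close>, for \<open>g \<noteq> 0\<close>.\<close>
  define t where "t i = dot m (x (Suc i)) (x 0) / g" for i
  define y where "y i = (\<lambda>k. x (Suc i) k - t i * x 0 k)" for i
  have shift: "(\<Prod>i<Suc n. dot m (x i) (x i)) = g * (\<Prod>i<n. dot m (x (Suc i)) (x (Suc i)))"
    unfolding g_def by (rule prod.lessThan_Suc_shift)
  show ?case
  proof (cases "g = 0")
    case True
    then have "\<forall>k<m. x 0 k = 0"
      unfolding g_def dot_def by (subst (asm) sum_nonneg_eq_0_iff) auto
    then have z: "dot m (x i) (x 0) = 0" for i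
      unfolding dot_def by (intro sum.neutral) auto
    have "det (mat (Suc n) (Suc n) (\<lambda>(i, j). dot m (x i) (x j))) = 0"
      by (subst det_first_column) (auto simp: z)
    then show ?thesis
      using True g_def by (auto simp: shift simp del: prod.lessThan_Suc)
  next
    case False
    then have g: "g > 0"
      using dot_nonneg[of "x 0"] by (simp add: g_def)
    have yy: "dot m (y i) (y j) = dot m (x (Suc i)) (x (Suc j)) - t i * dot m (x 0) (x (Suc j))" for i j
    proof -
      have "dot m (y i) (y j) = dot m (x (Suc i)) (x (Suc j)) - t i * dot m (x 0) (x (Suc j))
          - t j * dot m (x (Suc i)) (x 0) + t i * t j * g"
        by (simp add: dot_def y_def g_def algebra_simps sum.distrib sum_subtractf sum_distrib_left)
      also have "t j * dot m (x (Suc i)) (x 0) = t i * t j * g"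
        using False by (simp add: t_def)
      finally show ?thesis by simp
    qed
    have diag: "dot m (y i) (y i) = dot m (x (Suc i)) (x (Suc i)) - (t i)\<^sup>2 * g" for i
      using False by (simp add: yy dot_commute[of "x 0"] t_def power2_eq_square)
    have det: "det (mat (Suc n) (Suc n) (\<lambda>(i, j). dot m (x i) (x j))) = g * det (mat n n (\<lambda>(i, j). dot m (y i) (y j)))"
      using False by (subst det_clear_first_column[where t = t]) (auto simp: g_def t_def yy)
    have le: "dot m (y i) (y i) \<le> dot m (x (Suc i)) (x (Suc i))" for i
      using g by (simp add: diag)
    have prod_le: "(\<Prod>i<n. dot m (y i) (y i)) \<le> (\<Prod>i<n. dot m (x (Suc i)) (x (Suc i)))"
      by (rule prod_mono) (auto simp: dot_nonneg le)
    have IH: "0 \<le> det (mat n n (\<lambda>(i, j). dot m (y i) (y j)))"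
      "det (mat n n (\<lambda>(i, j). dot m (y i) (y j))) \<le> (\<Prod>i<n. dot m (y i) (y i))"
      "det (mat n n (\<lambda>(i, j). dot m (y i) (y j))) = (\<Prod>i<n. dot m (y i) (y i)) \<Longrightarrow> (\<forall>i<n. dot m (y i) (y i) \<noteq> 0)
       \<Longrightarrow> (\<forall>i<n. \<forall>j<n. i \<noteq> j \<longrightarrow> dot m (y i) (y j) = 0)"
      using Suc.IH[of y] by blast+
    show ?thesis
    proof (intro conjI impI)
      show "0 \<le> det (mat (Suc n) (Suc n) (\<lambda>(i, j). dot m (x i) (x j)))"
        using g IH(1) by (simp add: det)
      show "det (mat (Suc n) (Suc n) (\<lambda>(i, j). dot m (x i) (x j))) \<le> (\<Prod>i<Suc n. dot m (x i) (x i))"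
        unfolding det shift using g IH(2) prod_le by (intro mult_left_mono) auto
      assume eq: "det (mat (Suc n) (Suc n) (\<lambda>(i, j). dot m (x i) (x j))) = (\<Prod>i<Suc n. dot m (x i) (x i))"
        and nz: "\<forall>i<Suc n. dot m (x i) (x i) \<noteq> 0"
      have eq': "det (mat n n (\<lambda>(i, j). dot m (y i) (y j))) = (\<Prod>i<n. dot m (x (Suc i)) (x (Suc i)))"
        using eq g unfolding det shift by simp
      have pos: "dot m (x (Suc i)) (x (Suc i)) > 0" if "i < n" for i
        using nz that dot_nonneg[of "x (Suc i)"] by (metis Suc_less_eq less_eq_real_def)
      have prods: "(\<Prod>i<n. dot m (y i) (y i)) = (\<Prod>i<n. dot m (x (Suc i)) (x (Suc i)))"
        using eq' IH(2) prod_le by linarith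
      have t0: "t i = 0" if "i < n" for i
      proof (rule ccontr)
        assume "t i \<noteq> 0"
        then have lt: "dot m (y i) (y i) < dot m (x (Suc i)) (x (Suc i))"
          using g by (simp add: diag)
        have "(\<Prod>i<n. dot m (y i) (y i)) < (\<Prod>i<n. dot m (x (Suc i)) (x (Suc i)))"
          by (rule prod_mono_strict[of i]) (use that lt pos le dot_nonneg in auto)
        then show False using prods by simp
      qed
      then have y: "y i = x (Suc i)" if "i < n" for i
        using that by (simp add: y_def)
      have orth: "\<forall>i<n. \<forall>j<n. i \<noteq> j \<longrightarrow> dot m (y i) (y j) = 0"
        using IH(3) eq' prods y pos by (metis less_irrefl)
      have first: "dot m (x (Suc i)) (x 0) = 0" if "i < n" for i
        using t0[OF that] False by (simp add: t_def)
      show "\<forall>i<Suc n. \<forall>j<Suc n. i \<noteq> j \<longrightarrow> dot m (x i) (x j) = 0"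
      proof (intro allI impI)
        fix i j assume "i < Suc n" "j < Suc n" "i \<noteq> j"
        then show "dot m (x i) (x j) = 0"
          using orth first y dot_commute[of "x 0"] by (cases i; cases j) auto
      qed
    qed
  qed
qed

lemma det_gram_le_prod:
  "det (mat n n (\<lambda>(i, j). dot m (x i) (x j))) \<le> (\<Prod>i<n. dot m (x i) (x i))"
  using hadamard_gram by blast

lemma orthogonal_if_det_gram_eq_prod:
  assumes "det (mat n n (\<lambda>(i, j). dot m (x i) (x j))) = (\<Prod>i<n. dot m (x i) (x i))"
    and "\<And>i. i < n \<Longrightarrow> dot m (x i) (x i) \<noteq> 0" and "i < n" "j < n" "i \<noteq> j"
  shows "dot m (x i) (x j) = 0"
  using hadamard_gram assms by blast

section \<open>The matrix tree theorem for functions on a finite set\<close>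

text \<open>
  The matrix is \<open>I - F\<close>, where \<open>F\<close> is the incidence matrix of \<open>f\<close> with the column of the root \<open>v\<close> removed. If every
  orbit reaches the root, then \<open>F\<close> is nilpotent; in the Leibniz formula a permutation \<open>p\<close> with
  a nonzero term has to follow \<open>f\<close> on all points that it moves, which would trap an orbit of \<open>f\<close> among these points, so
  only the identity survives. Otherwise the indicator vector of the points that never reach the root is in the
  kernel, because \<open>u\<close> reaches the root if and only if \<open>f u\<close> does.
\<close>

lemma det_function_matrix:
  assumes dist: "distinct us" and v: "v \<notin> set us"
    and f: "\<And>u. u \<in> set us \<Longrightarrow> f u \<in> insert v (set us)"
  defines "m \<equiv> length us"
  shows "det (mat m m (\<lambda>(i, j). (if i = j then 1 else 0) - (if us ! j = f (us ! i) then 1 else 0))) =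
    (if \<forall>u\<in>set us. \<exists>k. (f ^^ k) u = v then 1 else 0 :: real)"
proof -
  let ?e = "\<lambda>i j. (if i = j then 1 else 0) - (if us ! j = f (us ! i) then 1 else 0) :: real"
  let ?A = "mat m m (\<lambda>(i, j). ?e i j)"
  have nth: "us ! i \<in> set us" if "i < m" for i
    using that by (simp add: m_def)
  show ?thesis
  proof (cases "\<forall>u\<in>set us. \<exists>k. (f ^^ k) u = v")
    case True
    have only_id: "(\<Prod>i = 0..<m. ?e i (p i)) = 0" if p: "p permutes {0..<m}" and "p \<noteq> id" for p
    proof (rule ccontr)
      assume nz: "(\<Prod>i = 0..<m. ?e i (p i)) \<noteq> 0"
      obtain i where i: "p i \<noteq> i"
        using \<open>p \<noteq> id\<close> by (auto simp: fun_eq_iff)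
      then have "i < m"
        using p by (metis atLeastLessThan_iff permutes_not_in zero_le)
      have "(f ^^ k) (us ! i) = us ! ((p ^^ k) i) \<and> (p ^^ k) i < m \<and> p ((p ^^ k) i) \<noteq> (p ^^ k) i" for k
      proof (induction k)
        case 0
        then show ?case using i \<open>i < m\<close> by simp
      next
        case (Suc k)
        let ?j = "(p ^^ k) i"
        have "?j < m" and not_fixed: "?j \<noteq> p ?j"
          using Suc by auto
        with nz have "?e ?j (p ?j) \<noteq> 0"
          by (metis (no_types, lifting) atLeastLessThan_iff finite_atLeastLessThan le0 prod_zero_iff)
        with not_fixed have "us ! (p ?j) = f (us ! ?j)"
          by (auto split: if_splits)
        moreover have "p ?j < m"
          using p Suc by (metis atLeastLessThan_iff permutes_in_image zero_le)
        moreover have "p (p ?j) \<noteq> p ?j"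
          using p Suc by (metis permutes_inverses(2))
        ultimately show ?case
          using Suc by simp
      qed
      then have "(f ^^ k) (us ! i) \<noteq> v" for k
        using v nth by metis
      then show False
        using True nth[OF \<open>i < m\<close>] by blast
    qed
    have no_loop: "us ! i \<noteq> f (us ! i)" if "i < m" for i
    proof
      assume "us ! i = f (us ! i)"
      then have "(f ^^ k) (us ! i) = us ! i" for k
        by (induction k) auto
      then show False
        using True nth[OF that] v by metis
    qed
    have "det ?A = (\<Sum>p | p permutes {0..<m}. signof p * (\<Prod>i = 0..<m. ?A $$ (i, p i)))"
      by (rule det_def') auto
    also have "\<dots> = (\<Sum>p | p permutes {0..<m}. signof p * (\<Prod>i = 0..<m. ?e i (p i)))"
    proof (intro sum.cong refl arg_cong2[of _ _ _ _ "(*)"] prod.cong)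
      fix p i assume "p \<in> {p. p permutes {0..<m}}" "i \<in> {0..<m}"
      then have "p i < m" "i < m"
        using permutes_in_image[of p "{0..<m}" i] by auto
      then show "?A $$ (i, p i) = ?e i (p i)" by simp
    qed
    also have "\<dots> = (\<Sum>p\<in>{id}. signof p * (\<Prod>i = 0..<m. ?e i (p i)))"
      by (rule sum.mono_neutral_right) (auto simp: finite_permutations permutes_id only_id)
    also have "\<dots> = 1"
      by (simp add: no_loop)
    finally show ?thesis using True by simp
  next
    case False
    define S where "S = {u \<in> set us. \<forall>k. (f ^^ k) u \<noteq> v}"
    have closed: "f u \<in> S \<longleftrightarrow> u \<in> S" if "u \<in> set us" for u
    proof
      assume "f u \<in> S"
      have "(f ^^ k) u \<noteq> v" for k
      proof (cases k)
        case 0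
        then show ?thesis using that v by auto
      next
        case (Suc l)
        then show ?thesis
          using \<open>f u \<in> S\<close> by (simp add: S_def funpow_swap1)
      qed
      then show "u \<in> S" using that by (simp add: S_def)
    next
      assume u: "u \<in> S"
      have "(f ^^ k) (f u) \<noteq> v" for k
        using u unfolding S_def by (metis (mono_tags, lifting) funpow_swap1 funpow.simps(2) comp_apply mem_Collect_eq)
      moreover from this[of 0] have "f u \<in> set us"
        using f[OF that] by simp
      ultimately show "f u \<in> S" by (simp add: S_def)
    qed
    define w where "w = vec m (\<lambda>i. if us ! i \<in> S then 1 else 0 :: real)"
    obtain u where "u \<in> S"
      using False by (auto simp: S_def)
    then obtain i where i: "i < m" "us ! i \<in> S"
      by (metis (mono_tags, lifting) S_def in_set_conv_nth m_def mem_Collect_eq)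
    have "w \<noteq> 0\<^sub>v m"
    proof
      assume "w = 0\<^sub>v m"
      then have "w $ i = 0" using i by simp
      then show False using i by (simp add: w_def)
    qed
    moreover have "?A *\<^sub>v w = 0\<^sub>v m"
    proof (rule eq_vecI)
      fix i assume "i < dim_vec (0\<^sub>v m :: real vec)"
      then have i: "i < m" by simp
      have "(?A *\<^sub>v w) $ i = (\<Sum>j\<in>{0..<m}. ?e i j * (if us ! j \<in> S then 1 else 0))"
        using i by (simp add: w_def scalar_prod_def)
      also have "\<dots> = (\<Sum>j\<in>{0..<m}. if i = j then if us ! j \<in> S then 1 else 0 else 0) -
          (\<Sum>j\<in>{0..<m}. if us ! j = f (us ! i) then if f (us ! i) \<in> S then 1 else 0 else 0)"
        unfolding sum_subtractf[symmetric] by (intro sum.cong) auto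
      also have "(\<Sum>j\<in>{0..<m}. if us ! j = f (us ! i) then if f (us ! i) \<in> S then 1 else 0 else 0) =
          (if f (us ! i) \<in> S then 1 else 0 :: real)"
      proof (cases "f (us ! i) \<in> S")
        case True
        then obtain l where l: "l < m" "us ! l = f (us ! i)"
          by (metis (mono_tags, lifting) S_def in_set_conv_nth m_def mem_Collect_eq)
        have "us ! j = f (us ! i) \<longleftrightarrow> j = l" if "j < m" for j
          using that l dist by (metis m_def nth_eq_iff_index_eq)
        then have "(\<Sum>j\<in>{0..<m}. if us ! j = f (us ! i) then 1 else 0) = (\<Sum>j\<in>{0..<m}. if j = l then 1 else 0 :: real)"
          by (intro sum.cong) auto
        then show ?thesis using True l by simp
      qed (simp add: sum.neutral)
      finally show "(?A *\<^sub>v w) $ i = 0\<^sub>v m $ i"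
        using i closed[OF nth[OF i]] by simp
    qed simp
    ultimately have "det ?A = 0"
      by (subst det_0_iff_vec_prod_zero[of _ m]) (auto simp: w_def intro!: exI[of _ w])
    then show ?thesis using False by simp
  qed
qed

text \<open>
  Row \<open>u\<close> of the Laplacian is the sum, over the successors \<open>w \<in> B u\<close>, of the unit vector of \<open>u\<close> minus the one of \<open>w\<close>,
  which is zero for the root. By
  multilinearity the determinant is a sum over all ways to choose a successor \<open>f u\<close> for every \<open>u\<close>, and each choice
  counts \<open>1\<close> or \<open>0\<close> according to whether all of its orbits reach the root.
\<close>

lemma matrix_tree:
  assumes dist: "distinct us" and v: "v \<notin> set us"
    and B: "\<And>u. u \<in> set us \<Longrightarrow> B u \<subseteq> insert v (set us)"
  defines "m \<equiv> length us"
  shows "det (mat m m (\<lambda>(i, j). (if i = j then real (card (B (us ! i))) else 0)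
      - (if us ! j \<in> B (us ! i) then 1 else 0))) =
    real (card {f \<in> PiE (set us) B. \<forall>u\<in>set us. \<exists>k. (f ^^ k) u = v})"
proof -
  let ?e = "\<lambda>x i j. (if i = j then 1 else 0) - (if us ! j = x then 1 else 0) :: real"
  let ?F = "PiE (set us) B"
  have finB: "finite (B u)" if "u \<in> set us" for u
    using B[OF that] by (rule finite_subset) simp
  then have finF: "finite ?F"
    by (intro finite_PiE) auto
  have bij: "bij_betw (nth us) {0..<m} (set us)"
    using bij_betw_nth[OF dist] by (simp add: m_def atLeast0LessThan)
  have row: "(if i = j then real (card (B (us ! i))) else 0) - (if us ! j \<in> B (us ! i) then 1 else 0)
      = (\<Sum>x\<in>B (us ! i). ?e x i j)" if "i < m" for i j
    using finB[of "us ! i"] that by (simp add: sum_subtractf m_def)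
  \<comment> \<open>Multilinearity is obtained by expanding the products in the Leibniz formula; \<open>?ix\<close> turns positions in
    \<open>us\<close> into vertices, so that the choices range over functions on vertices.\<close>
  have "det (mat m m (\<lambda>(i, j). (if i = j then real (card (B (us ! i))) else 0)
      - (if us ! j \<in> B (us ! i) then 1 else 0))) = det (mat m m (\<lambda>(i, j). \<Sum>x\<in>B (us ! i). ?e x i j))"
    by (rule det_mat_cong) (rule row)
  also have "\<dots> = (\<Sum>p | p permutes {0..<m}. signof p * (\<Prod>i = 0..<m. \<Sum>x\<in>B (us ! i). ?e x i (p i)))"
  proof (subst det_def'[of _ m], simp, intro sum.cong refl arg_cong2[of _ _ _ _ "(*)"] prod.cong)
    fix p i assume "p \<in> {p. p permutes {0..<m}}" "i \<in> {0..<m}"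
    then have "p i < m" "i < m"
      using permutes_in_image[of p "{0..<m}" i] by auto
    then show "mat m m (\<lambda>(i, j). \<Sum>x\<in>B (us ! i). ?e x i j) $$ (i, p i) = (\<Sum>x\<in>B (us ! i). ?e x i (p i))"
      by simp
  qed
  also have "\<dots> = (\<Sum>p | p permutes {0..<m}. signof p * (\<Sum>f\<in>?F. \<Prod>i = 0..<m. ?e (f (us ! i)) i (p i)))"
  proof (intro sum.cong refl arg_cong2[of _ _ _ _ "(*)"])
    fix p
    let ?ix = "the_inv_into {0..<m} (nth us)"
    have ix: "?ix (us ! i) = i" if "i \<in> {0..<m}" for i
      using bij that by (simp add: bij_betw_def the_inv_into_f_f)
    have "(\<Prod>i = 0..<m. \<Sum>x\<in>B (us ! i). ?e x i (p i)) = (\<Prod>i = 0..<m. \<Sum>x\<in>B (us ! i). ?e x (?ix (us ! i)) (p (?ix (us ! i))))"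
      by (intro prod.cong) (auto simp: ix)
    also have "\<dots> = (\<Prod>u\<in>set us. \<Sum>x\<in>B u. ?e x (?ix u) (p (?ix u)))"
      by (rule prod.reindex_bij_betw[OF bij])
    also have "\<dots> = (\<Sum>f\<in>?F. \<Prod>u\<in>set us. ?e (f u) (?ix u) (p (?ix u)))"
      by (rule prod_sum_PiE) (auto simp: finB)
    also have "\<dots> = (\<Sum>f\<in>?F. \<Prod>i = 0..<m. ?e (f (us ! i)) (?ix (us ! i)) (p (?ix (us ! i))))"
      by (intro sum.cong refl prod.reindex_bij_betw[OF bij, symmetric])
    also have "\<dots> = (\<Sum>f\<in>?F. \<Prod>i = 0..<m. ?e (f (us ! i)) i (p i))"
      by (intro sum.cong prod.cong) (auto simp: ix)
    finally show "(\<Prod>i = 0..<m. \<Sum>x\<in>B (us ! i). ?e x i (p i)) = (\<Sum>f\<in>?F. \<Prod>i = 0..<m. ?e (f (us ! i)) i (p i))" .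
  qed
  also have "\<dots> = (\<Sum>f\<in>?F. \<Sum>p | p permutes {0..<m}. signof p * (\<Prod>i = 0..<m. ?e (f (us ! i)) i (p i)))"
    unfolding sum_distrib_left by (rule sum.swap)
  also have "\<dots> = (\<Sum>f\<in>?F. det (mat m m (\<lambda>(i, j). ?e (f (us ! i)) i j)))"
  proof (intro sum.cong refl, subst det_def'[of _ m], simp, intro sum.cong refl arg_cong2[of _ _ _ _ "(*)"] prod.cong)
    fix f p i assume "p \<in> {p. p permutes {0..<m}}" "i \<in> {0..<m}"
    then have "p i < m" "i < m"
      using permutes_in_image[of p "{0..<m}" i] by auto
    then show "?e (f (us ! i)) i (p i) = mat m m (\<lambda>(i, j). ?e (f (us ! i)) i j) $$ (i, p i)"
      by simp
  qed
  also have "\<dots> = (\<Sum>f\<in>?F. if \<forall>u\<in>set us. \<exists>k. (f ^^ k) u = v then 1 else 0)"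
  proof (intro sum.cong refl)
    fix f assume "f \<in> ?F"
    then have "\<And>u. u \<in> set us \<Longrightarrow> f u \<in> insert v (set us)"
      using B by (auto dest: PiE_mem)
    then show "det (mat m m (\<lambda>(i, j). ?e (f (us ! i)) i j)) =
        (if \<forall>u\<in>set us. \<exists>k. (f ^^ k) u = v then 1 else 0)"
      unfolding m_def by (rule det_function_matrix[OF dist v])
  qed
  also have "\<dots> = real (card {f \<in> ?F. \<forall>u\<in>set us. \<exists>k. (f ^^ k) u = v})"
    using finF by (simp add: sum.If_cases Int_def)
  finally show ?thesis .
qed

section \<open>Arborescences as parent functions\<close>

text \<open>
  The candidate arborescence in which \<open>f u\<close> is the parent of \<open>u\<close>, for \<open>u \<noteq> v\<close>.
\<close>

definition function_graph :: "('a, 'b) pre_digraph \<Rightarrow> 'a \<Rightarrow> ('a \<Rightarrow> 'a) \<Rightarrow> ('a, 'b) pre_digraph" where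
  "function_graph G v f = \<lparr>verts = verts G, arcs = {e \<in> arcs G. tail G e \<noteq> v \<and> head G e = f (tail G e)},
     tail = tail G, head = head G\<rparr>"

lemma spanning_function_graph:
  assumes "wf_digraph G"
  shows "spanning (function_graph G v f) G"
proof -
  interpret wf_digraph G by fact
  show ?thesis
    using assms
    by (auto simp: spanning_def subgraph_def function_graph_def compatible_def wf_digraph_def)
      (metis head_in_verts)
qed

lemma out_arcs_function_graph:
  assumes "digraph G" and "(u, f u) \<in> arcs_ends G" and "u \<noteq> v"
  obtains e where "e \<in> arcs G" "tail G e = u" "head G e = f u" "out_arcs (function_graph G v f) u = {e}"
proof -
  interpret digraph G by fact
  obtain e where e: "e \<in> arcs G" "tail G e = u" "head G e = f u"
    using assms(2) by (auto simp: arcs_ends_conv)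
  have "e' \<in> out_arcs (function_graph G v f) u \<longleftrightarrow> e' = e" for e'
    using no_multi_arcs[of e' e] e assms(3) by (auto simp: arc_to_ends_def function_graph_def)
  then have "out_arcs (function_graph G v f) u = {e}"
    by blast
  with e that show ?thesis by blast
qed

text \<open>
  With \<open>d\<close> the distance to the root, every step of a walk decreases \<open>d\<close>, so a nonempty walk cannot be closed.
\<close>

lemma forest_if_decreasing:
  fixes d :: "'a \<Rightarrow> nat"
  assumes "\<And>e. e \<in> arcs H \<Longrightarrow> d (head H e) < d (tail H e)"
  shows "forest H"
proof -
  have walk: "pre_digraph.cas H u p w \<Longrightarrow> set p \<subseteq> arcs H \<Longrightarrow> p = [] \<and> u = w \<or> d w < d u" for u p w
  proof (induction p arbitrary: u)
    case Nil
    then show ?case by (simp add: pre_digraph.cas.simps)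
  next
    case (Cons e p)
    then have "d (head H e) < d u" "pre_digraph.cas H (head H e) p w"
      using assms[of e] by (simp_all add: pre_digraph.cas.simps)
    then show ?case
      using Cons.IH[of "head H e"] Cons.prems(2) by auto
  qed
  show ?thesis
    unfolding forest_def pre_digraph.cycle_def pre_digraph.awalk_def by (metis walk less_irrefl)
qed

lemma pcas_ends: "pcas u p w \<Longrightarrow> p \<noteq> [] \<Longrightarrow> fst (p ! 0) = u \<and> snd (p ! (length p - 1)) = w"
  by (induction u p w rule: pcas.induct)
    (auto simp: nth_Cons split: nat.splits, metis length_0_conv nat.distinct(1))

lemma pcas_consecutive: "pcas u p w \<Longrightarrow> Suc i < length p \<Longrightarrow> snd (p ! i) = fst (p ! Suc i)"
proof (induction p arbitrary: u i)
  case (Cons e p)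
  then show ?case
    using pcas_ends[of "snd e" p w] by (cases i) auto
qed simp

lemma tl_pawalk_verts: "pcas u p w \<Longrightarrow> tl (pawalk_verts u p) = map snd p"
proof (induction p arbitrary: u)
  case (Cons e p)
  then show ?case by (cases p) auto
qed simp

text \<open>
  A vertex of the cycle on which \<open>d\<close> is maximal has two neighbours on the cycle with smaller \<open>d\<close>. If these
  must coincide, the cycle only runs back and forth along one edge. For a tree, \<open>d\<close> is the distance to the root, and the
  only neighbour of smaller distance is the parent.
\<close>

lemma cycle_length_less_3_if_unique_descent:
  fixes d :: "'a \<Rightarrow> nat"
  assumes arcs: "\<And>a b. (a, b) \<in> parcs P \<Longrightarrow> d a \<noteq> d b"
    and up: "\<And>a b c. (a, b) \<in> parcs P \<Longrightarrow> (b, c) \<in> parcs P \<Longrightarrow> d a < d b \<Longrightarrow> d c < d b \<Longrightarrow> a = c"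
    and cycle: "pre_digraph.cycle (with_proj P) p"
  shows "length p < 3"
proof (rule ccontr)
  assume "\<not> length p < 3"
  then have len: "length p \<ge> 3" by simp
  define l where "l = length p"
  obtain u where "set p \<subseteq> parcs P" "pcas u p u" "distinct (tl (pawalk_verts u p))"
    using cycle unfolding pre_digraph.cycle_def pre_digraph.awalk_def
    by (auto simp: cas_with_proj_eq awalk_verts_with_proj_eq)
  then have u: "set p \<subseteq> parcs P" "pcas u p u" "distinct (map snd p)"
    by (simp_all only: tl_pawalk_verts)
  have next_arc: "snd (p ! i) = fst (p ! (if Suc i = l then 0 else Suc i))" if "i < l" for i
  proof (cases "Suc i = l")
    case True
    then have "i = length p - 1" "p \<noteq> []"
      by (auto simp: l_def)
    then show ?thesis
      using pcas_ends[OF u(2)] True by (simp only: if_True refl simp_thms)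
  next
    case False
    then show ?thesis
      using pcas_consecutive[OF u(2), of i] that by (simp add: l_def)
  qed
  obtain j where j: "j < l" "\<And>i. i < l \<Longrightarrow> d (snd (p ! i)) \<le> d (snd (p ! j))"
  proof -
    have "finite ((\<lambda>i. d (snd (p ! i))) ` {..<l})" "(\<lambda>i. d (snd (p ! i))) ` {..<l} \<noteq> {}"
      using len by (auto simp: l_def lessThan_empty_iff)
    then have "Max ((\<lambda>i. d (snd (p ! i))) ` {..<l}) \<in> (\<lambda>i. d (snd (p ! i))) ` {..<l}"
      by (rule Max_in)
    then obtain j where "j < l" "Max ((\<lambda>i. d (snd (p ! i))) ` {..<l}) = d (snd (p ! j))"
      by auto
    then show ?thesis
      using that[of j] by (metis Max_ge finite_imageI finite_lessThan imageI lessThan_iff)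
  qed
  \<comment> \<open>\<open>i\<close> and \<open>k\<close> are the cyclic predecessor and successor of \<open>j\<close>; they differ because \<open>l \<ge> 3\<close>.\<close>
  define i where "i = (if j = 0 then l - 1 else j - 1)"
  define k where "k = (if Suc j = l then 0 else Suc j)"
  have ik: "i < l" "k < l" "i \<noteq> k"
    using j(1) len by (auto simp: i_def k_def l_def)
  have pj: "p ! j = (snd (p ! i), snd (p ! j))"
    using next_arc[OF ik(1)] j(1) len by (auto simp: i_def l_def prod_eq_iff split: if_splits)
  have pk: "p ! k = (snd (p ! j), snd (p ! k))"
    using next_arc[OF j(1)] by (auto simp: k_def prod_eq_iff)
  have arc: "p ! i \<in> parcs P" if "i < l" for i
    using u(1) that by (auto simp: l_def)
  have "(snd (p ! i), snd (p ! j)) \<in> parcs P" "(snd (p ! j), snd (p ! k)) \<in> parcs P"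
    using arc[OF j(1)] arc[OF ik(2)] pj pk by auto
  moreover from this have "d (snd (p ! i)) < d (snd (p ! j))" "d (snd (p ! k)) < d (snd (p ! j))"
    using arcs j(2) ik by (metis le_neq_implies_less)+
  ultimately have "snd (p ! i) = snd (p ! k)"
    by (rule up)
  then show False
    using u(3) ik by (simp add: distinct_conv_nth l_def)
qed

text \<open>
  The number \<open>d u\<close> of steps from \<open>u\<close> to the root drops by one along every arc. This excludes directed and undirected
  cycles, and the paths to the root provide connectedness.
\<close>

lemma arborescence_function_graph:
  assumes "digraph G" and v: "v \<in> verts G"
    and f: "\<And>u. u \<in> verts G - {v} \<Longrightarrow> (u, f u) \<in> arcs_ends G"
    and reach: "\<And>u. u \<in> verts G - {v} \<Longrightarrow> \<exists>k. (f ^^ k) u = v"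
  shows "arborescence G v (function_graph G v f)"
proof -
  interpret digraph G by fact
  let ?H = "function_graph G v f"
  have sp: "spanning ?H G"
    by (rule spanning_function_graph) unfold_locales
  then interpret H: wf_digraph ?H
    by (simp add: spanning_def subgraph_def)
  define d where "d u = (LEAST k. (f ^^ k) u = v)" for u
  have d_step: "d u = Suc (d (f u))" if u: "u \<in> verts G - {v}" for u
  proof -
    obtain k where "(f ^^ k) u = v" using reach[OF u] by blast
    then have "d u = Suc (LEAST k. (f ^^ Suc k) u = v)"
      unfolding d_def by (rule Least_Suc) (use u in simp)
    then show ?thesis by (simp add: d_def funpow_swap1)
  qed
  have arc: "tail G e \<in> verts G - {v}" "head G e = f (tail G e)" if "e \<in> arcs ?H" for e
    using that by (auto simp: function_graph_def)
  have forest: "forest ?H"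
  proof (rule forest_if_decreasing)
    fix e assume "e \<in> arcs ?H"
    then show "d (head ?H e) < d (tail ?H e)"
      using arc[of e] d_step[of "tail G e"] by (simp add: function_graph_def)
  qed
  have sym_arc: "b = f a \<and> d a = Suc (d b) \<or> a = f b \<and> d b = Suc (d a)" if "(a, b) \<in> parcs (mk_symmetric ?H)" for a b
  proof -
    have "\<exists>e\<in>arcs ?H. (a, b) = (tail G e, head G e) \<or> (a, b) = (head G e, tail G e)"
      using that by (auto simp: parcs_mk_symmetric function_graph_def)
    then obtain e where e: "e \<in> arcs ?H" "(a, b) = (tail G e, head G e) \<or> (a, b) = (head G e, tail G e)"
      by blast
    then show ?thesis
      using arc[OF e(1)] d_step[OF arc(1)[OF e(1)]] by auto
  qed
  have no_cycle: "\<not> (\<exists>p. pre_digraph.cycle (with_proj (mk_symmetric ?H)) p \<and> length p \<ge> 3)"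
  proof
    assume "\<exists>p. pre_digraph.cycle (with_proj (mk_symmetric ?H)) p \<and> length p \<ge> 3"
    then obtain p where p: "pre_digraph.cycle (with_proj (mk_symmetric ?H)) p" "length p \<ge> 3" by blast
    have "length p < 3"
      using p(1) by (rule cycle_length_less_3_if_unique_descent[where d = d, rotated 2]) (metis sym_arc n_not_Suc_n not_less_eq less_irrefl lessI not_less_iff_gr_or_eq)+
    then show False using p(2) by simp
  qed
  have adj: "(u, f u) \<in> arcs_ends ?H" if u: "u \<in> verts G - {v}" for u
  proof -
    have "u \<noteq> v" using u by blast
    from out_arcs_function_graph[where f = f, OF assms(1) f[OF u] this] obtain e where
      "e \<in> arcs G" "tail G e = u" "head G e = f u" by blast
    then show ?thesis
      using u by (auto simp: arcs_ends_conv function_graph_def)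
  qed
  have root_refl: "v \<rightarrow>\<^sup>*\<^bsub>?H\<^esub> v"
    using v by (intro H.reachable_refl) (simp add: function_graph_def)
  have to_v: "u \<in> verts G \<Longrightarrow> (f ^^ k) u = v \<Longrightarrow> u \<rightarrow>\<^sup>*\<^bsub>?H\<^esub> v" for u k
  proof (induction k arbitrary: u)
    case 0
    then show ?case using root_refl by simp
  next
    case (Suc k)
    show ?case
    proof (cases "u = v")
      case True
      then show ?thesis using root_refl by simp
    next
      case False
      then have "(u, f u) \<in> arcs_ends ?H" using adj Suc by simp
      moreover from this have "f u \<in> verts G"
        using H.adj_in_verts(2)[of u "f u"] by (simp add: function_graph_def)
      then have "f u \<rightarrow>\<^sup>*\<^bsub>?H\<^esub> v"
        using Suc.prems(2) by (intro Suc.IH) (simp_all add: funpow_swap1)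
      ultimately show ?thesis
        by (rule H.adj_reachable_trans)
    qed
  qed
  have con: "connected ?H"
    unfolding connected_def strongly_connected_def
  proof (intro conjI ballI)
    show "verts (with_proj (mk_symmetric ?H)) \<noteq> {}"
      using v by (auto simp: function_graph_def)
    have root: "u \<rightarrow>\<^sup>*\<^bsub>mk_symmetric ?H\<^esub> v" if "u \<in> verts (with_proj (mk_symmetric ?H))" for u
    proof -
      have u: "u \<in> verts G" using that by (simp add: function_graph_def)
      have "\<exists>k. (f ^^ k) u = v"
      proof (cases "u = v")
        case True
        then show ?thesis by (intro exI[of _ 0]) simp
      next
        case False
        then show ?thesis using reach u by simp
      qed
      then obtain k where "(f ^^ k) u = v" by blast
      then show ?thesis
        by (intro H.reachable_mk_symmetricI to_v[OF u])
    qed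
    interpret S: pair_wf_digraph "mk_symmetric ?H" ..
    fix u w assume "u \<in> verts (with_proj (mk_symmetric ?H))" "w \<in> verts (with_proj (mk_symmetric ?H))"
    then show "u \<rightarrow>\<^sup>*\<^bsub>mk_symmetric ?H\<^esub> w"
      by (meson root symmetric_reachable[OF symmetric_mk_symmetric] S.reachable_trans)
  qed
  have "out_degree ?H v = 0"
    by (simp add: out_degree_def out_arcs_def function_graph_def)
  moreover have "out_degree ?H u = 1" if u: "u \<in> verts G - {v}" for u
  proof -
    have "u \<noteq> v" using u by blast
    from out_arcs_function_graph[where f = f, OF assms(1) f[OF u] this] obtain e where
      "out_arcs ?H u = {e}" by blast
    then show ?thesis by (simp add: out_degree_def)
  qed
  ultimately show ?thesis
    using sp con forest no_cycle v
    by (simp add: arborescence_def undirected_spanning_tree_def undirected_forest_def)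
qed

text \<open>
  The outdegrees define \<open>f\<close>. That all orbits reach the root uses connectedness instead of
  acyclicity: reaching the root is passed on along arcs in both directions, and every vertex is joined to
  the root by a path in the underlying undirected graph.
\<close>

lemma arborescence_is_function_graph:
  assumes "digraph G" and H: "arborescence G v H"
  obtains f where "f \<in> PiE (verts G - {v}) (\<lambda>u. {w. (u, w) \<in> arcs_ends G})"
    "\<forall>u\<in>verts G - {v}. \<exists>k. (f ^^ k) u = v" "H = function_graph G v f"
proof -
  interpret digraph G by fact
  have v: "v \<in> verts G" and sp: "spanning H G" and con: "connected H"
    and deg_v: "out_degree H v = 0" and deg: "\<And>u. u \<in> verts G - {v} \<Longrightarrow> out_degree H u = 1"
    using H by (auto simp: arborescence_def undirected_spanning_tree_def)
  have H_eq: "verts H = verts G" "tail H = tail G" "head H = head G" and sub: "arcs H \<subseteq> arcs G"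
    using sp by (auto simp: spanning_def subgraph_def compatible_def)
  have fin: "finite (out_arcs H u)" for u
    using sub by (auto simp: out_arcs_def intro: finite_subset)
  have tail_ne: "tail G e \<noteq> v" if "e \<in> arcs H" for e
    using deg_v fin[of v] that by (auto simp: out_degree_def out_arcs_def H_eq)
  define a where "a u = (THE e. e \<in> arcs H \<and> tail G e = u)" for u
  have a: "a u \<in> arcs H" "tail G (a u) = u" "\<And>e. e \<in> arcs H \<Longrightarrow> tail G e = u \<Longrightarrow> e = a u"
    if u: "u \<in> verts G - {v}" for u
  proof -
    obtain e where "out_arcs H u = {e}"
      using deg[OF u] by (auto simp: out_degree_def card_1_singleton_iff)
    then have e: "e' \<in> arcs H \<and> tail G e' = u \<longleftrightarrow> e' = e" for e'
      by (metis H_eq(2) in_out_arcs_conv singleton_iff)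
    then have "a u = e" unfolding a_def by simp
    then show "a u \<in> arcs H" "tail G (a u) = u" "\<And>e. e \<in> arcs H \<Longrightarrow> tail G e = u \<Longrightarrow> e = a u"
      using e by blast+
  qed
  define f where "f = restrict (\<lambda>u. head G (a u)) (verts G - {v})"
  have arc_H: "head G e = f (tail G e)" if e: "e \<in> arcs H" for e
  proof -
    have "tail G e \<in> verts G - {v}"
      using e sub tail_ne by auto
    then show ?thesis using a(3)[of "tail G e" e] e unfolding f_def by (metis restrict_apply')
  qed
  have "f \<in> PiE (verts G - {v}) (\<lambda>u. {w. (u, w) \<in> arcs_ends G})"
  proof (rule PiE_I)
    fix u assume u: "u \<in> verts G - {v}"
    then have "(tail G (a u), head G (a u)) \<in> arcs_ends G"
      using a(1)[OF u] sub by (auto simp: arcs_ends_conv)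
    then show "f u \<in> {w. (u, w) \<in> arcs_ends G}"
      using u a(2)[OF u] by (simp add: f_def)
  qed (auto simp: f_def)
  moreover have "H = function_graph G v f"
  proof -
    have "e \<in> arcs H" if e: "e \<in> arcs G" "tail G e \<noteq> v" "head G e = f (tail G e)" for e
    proof -
      have t: "tail G e \<in> verts G - {v}" using e by simp
      then have "e = a (tail G e)"
        using e a(1,2)[OF t] t sub by (intro no_multi_arcs) (auto simp: arc_to_ends_def f_def)
      then show ?thesis using a(1)[OF t] by simp
    qed
    then have "arcs H = {e \<in> arcs G. tail G e \<noteq> v \<and> head G e = f (tail G e)}"
      using sub tail_ne arc_H by auto
    then show ?thesis
      using H_eq by (intro pre_digraph.equality) (simp_all add: function_graph_def)
  qed
  moreover have "\<exists>k. (f ^^ k) u = v" if u: "u \<in> verts G - {v}" for u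
  proof -
    have "u \<rightarrow>\<^sup>*\<^bsub>mk_symmetric H\<^esub> v"
      using con u v H_eq by (auto simp: connected_def strongly_connected_def)
    then have "(u, v) \<in> (parcs (mk_symmetric H))\<^sup>*"
      by (auto dest: reachable_rtranclI)
    then show ?thesis
    proof (induction rule: converse_rtrancl_induct)
      case base
      show ?case by (rule exI[of _ 0]) simp
    next
      case (step x y)
      then obtain k where k: "(f ^^ k) y = v" by blast
      from step(1) obtain e where e: "e \<in> arcs H" "(x = tail G e \<and> y = head G e) \<or> (y = tail G e \<and> x = head G e)"
        by (auto simp: parcs_mk_symmetric H_eq)
      then have "y = f x \<or> y \<noteq> v \<and> x = f y"
        using arc_H[OF e(1)] tail_ne[OF e(1)] by auto
      then show ?case
      proof
        assume "y = f x"
        then have "(f ^^ Suc k) x = v"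
          using k by (simp add: funpow_swap1)
        then show ?thesis by blast
      next
        assume y: "y \<noteq> v \<and> x = f y"
        then obtain l where "k = Suc l"
          using k by (cases k) auto
        then have "(f ^^ l) x = v"
          using k y by (simp add: funpow_swap1)
        then show ?thesis by blast
      qed
    qed
  qed
  ultimately show ?thesis using that by blast
qed

lemma inj_on_function_graph:
  "inj_on (function_graph G v) (PiE (verts G - {v}) (\<lambda>u. {w. (u, w) \<in> arcs_ends G}))"
proof (rule inj_onI)
  fix f g
  assume f: "f \<in> PiE (verts G - {v}) (\<lambda>u. {w. (u, w) \<in> arcs_ends G})"
    and g: "g \<in> PiE (verts G - {v}) (\<lambda>u. {w. (u, w) \<in> arcs_ends G})"
    and eq: "function_graph G v f = function_graph G v g"
  show "f = g"
  proof (rule PiE_ext[OF f g])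
    fix u assume u: "u \<in> verts G - {v}"
    then have "(u, f u) \<in> arcs_ends G"
      using f by auto
    then obtain e where e: "e \<in> arcs G" "tail G e = u" "head G e = f u"
      by (auto simp: arcs_ends_conv)
    then have "e \<in> arcs (function_graph G v f)"
      using u by (simp add: function_graph_def)
    then have "e \<in> arcs (function_graph G v g)"
      using eq by simp
    then show "f u = g u"
      using e by (simp add: function_graph_def)
  qed
qed

lemma arb_eq_card_functions:
  assumes "digraph G" "v \<in> verts G"
  shows "arb G v = card {f \<in> PiE (verts G - {v}) (\<lambda>u. {w. (u, w) \<in> arcs_ends G}).
    \<forall>u\<in>verts G - {v}. \<exists>k. (f ^^ k) u = v}" (is "_ = card ?F")
proof -
  have "{H. arborescence G v H} = function_graph G v ` ?F"
  proof (rule antisym; rule subsetI)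
    fix H assume "H \<in> {H. arborescence G v H}"
    then show "H \<in> function_graph G v ` ?F"
      by (auto elim!: arborescence_is_function_graph[OF assms(1)])
  next
    fix H assume "H \<in> function_graph G v ` ?F"
    then obtain f where f: "f \<in> PiE (verts G - {v}) (\<lambda>u. {w. (u, w) \<in> arcs_ends G})"
      "\<forall>u\<in>verts G - {v}. \<exists>k. (f ^^ k) u = v" "H = function_graph G v f"
      by blast
    have "arborescence G v (function_graph G v f)"
    proof (rule arborescence_function_graph[OF assms])
      fix u assume "u \<in> verts G - {v}"
      then show "(u, f u) \<in> arcs_ends G" "\<exists>k. (f ^^ k) u = v"
        using PiE_mem[OF f(1)] f(2) by blast+
    qed
    then show "H \<in> {H. arborescence G v H}"
      using f(3) by simp
  qed
  moreover have "inj_on (function_graph G v) ?F"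
    by (rule inj_on_subset[OF inj_on_function_graph]) auto
  ultimately show ?thesis
    by (simp add: arb_def card_image)
qed

section \<open>The Gram matrix of an Eulerian tournament\<close>

lemma degree_eulerian_tournament:
  assumes T: "tournament T" and E: "eulerian T" and n: "card (verts T) = n" and u: "u \<in> verts T"
  shows "real (card {w. (u, w) \<in> arcs_ends T}) = (real n - 1) / 2"
    and "real (card {w. (w, u) \<in> arcs_ends T}) = (real n - 1) / 2"
proof -
  interpret digraph T
    using T by (simp add: tournament_def)
  let ?O = "{w. (u, w) \<in> arcs_ends T}" and ?I = "{w. (w, u) \<in> arcs_ends T}"
  have "bij_betw (head T) (out_arcs T u) ?O"
    unfolding bij_betw_def inj_on_def
  proof (intro conjI ballI impI)
    fix e e' assume "e \<in> out_arcs T u" "e' \<in> out_arcs T u" "head T e = head T e'"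
    then show "e = e'"
      by (intro no_multi_arcs) (auto simp: arc_to_ends_def)
  qed (auto simp: arcs_ends_conv)
  then have O: "card ?O = out_degree T u"
    by (simp add: out_degree_def bij_betw_same_card)
  have "bij_betw (tail T) (in_arcs T u) ?I"
    unfolding bij_betw_def inj_on_def
  proof (intro conjI ballI impI)
    fix e e' assume "e \<in> in_arcs T u" "e' \<in> in_arcs T u" "tail T e = tail T e'"
    then show "e = e'"
      by (intro no_multi_arcs) (auto simp: arc_to_ends_def)
  qed (auto simp: arcs_ends_conv)
  then have I: "card ?I = in_degree T u"
    by (simp add: in_degree_def bij_betw_same_card)
  have union: "?O \<union> ?I = verts T - {u}"
  proof (rule antisym; rule subsetI)
    fix w assume "w \<in> ?O \<union> ?I"
    then show "w \<in> verts T - {u}"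
      using adj_in_verts[of u w] adj_in_verts[of w u] adj_not_same[of u] by auto
  next
    fix w assume "w \<in> verts T - {u}"
    then show "w \<in> ?O \<union> ?I"
      using T u unfolding tournament_def by fastforce
  qed
  have disj: "?O \<inter> ?I = {}"
  proof (rule ccontr)
    assume "?O \<inter> ?I \<noteq> {}"
    then obtain w where w: "(u, w) \<in> arcs_ends T" "(w, u) \<in> arcs_ends T" by blast
    then have "w \<in> verts T" "u \<noteq> w"
      using adj_in_verts adj_not_same by metis+
    then show False
      using T u w unfolding tournament_def by metis
  qed
  have "finite (?O \<union> ?I)"
    unfolding union by simp
  then have "card ?O + card ?I = card (verts T - {u})"
    unfolding union[symmetric] using disj by (subst card_Un_disjoint) auto
  also have "\<dots> = n - 1"
    using u n by simp
  finally have "card ?O + card ?I = n - 1" .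
  moreover have "card ?I = card ?O"
    using E u O I by (simp add: eulerian_def)
  moreover have "n \<ge> 1"
    using u n by (metis One_nat_def Suc_leI card_gt_0_iff empty_iff finite_verts)
  ultimately show "real (card ?O) = (real n - 1) / 2" "real (card ?I) = (real n - 1) / 2"
    by (simp_all add: field_simps)
qed

text \<open>
  An enumeration of the vertices turns the graph into matrices. The vertex \<open>vs ! 0\<close> serves as the root: its row and
  column are the ones removed from the Laplacian.
\<close>

locale enumerated_eulerian_tournament =
  fixes T :: "('a, 'b) pre_digraph" and vs :: "'a list" and n :: nat
  assumes tournament: "tournament T" and eulerian: "eulerian T"
    and distinct_vs: "distinct vs" and set_vs: "set vs = verts T" and n_def: "n = length vs"
    and n_pos: "n > 0"
begin

sublocale digraph T
  using tournament by (simp add: tournament_def)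

lemma card_verts: "card (verts T) = n"
  using distinct_card[OF distinct_vs] by (simp add: set_vs n_def)

definition a :: "nat \<Rightarrow> nat \<Rightarrow> real" where
  "a i j = (if (vs ! i, vs ! j) \<in> arcs_ends T then 1 else 0)"

definition d :: real where "d = (real n - 1) / 2"

definition L :: "nat \<Rightarrow> nat \<Rightarrow> real" where
  "L i j = (if i = j then d else 0) - a i j"

text \<open>
  The shift \<open>c\<close> is chosen such that \<open>X = L + c J\<close> can be a multiple of an orthogonal matrix. On the
  all-ones vector \<open>X X\<^sup>T\<close> has the eigenvalue \<open>c\<^sup>2 n\<^sup>2\<close>, and the diagonal entries of \<open>X X\<^sup>T\<close> are
  \<open>(n\<^sup>2 - 1) / 4 + c\<^sup>2 n\<close>. These two numbers agree for \<open>c\<^sup>2 = (n + 1) / (4 n)\<close>, with common value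
  \<open>q\<close> below.
\<close>

definition c :: real where "c = sqrt ((real n + 1) / (4 * real n))"

definition q :: real where "q = real n * (real n + 1) / 4"

lemma nth_vs: "i < n \<Longrightarrow> vs ! i \<in> verts T"
  by (simp add: n_def flip: set_vs)

lemma sum_indicator:
  assumes "W \<subseteq> verts T"
  shows "(\<Sum>k<n. if vs ! k \<in> W then 1 else 0) = real (card W)"
proof -
  have "(\<Sum>k<n. if vs ! k \<in> W then 1 else 0) = (\<Sum>x\<in>verts T. if x \<in> W then 1 else 0 :: real)"
    by (rule sum.reindex_bij_betw) (rule bij_betw_nth[OF distinct_vs], simp_all add: n_def set_vs)
  also have "\<dots> = real (card W)"
    using assms by (simp add: sum.If_cases Int_absorb1)
  finally show ?thesis .
qed

lemma a_row:
  assumes "i < n"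
  shows "(\<Sum>k<n. a i k) = d"
proof -
  have "{w. (vs ! i, w) \<in> arcs_ends T} \<subseteq> verts T"
    using adj_in_verts(2) by blast
  from sum_indicator[OF this] show ?thesis
    using degree_eulerian_tournament(1)[OF tournament eulerian card_verts nth_vs[OF assms]]
    by (simp add: a_def d_def)
qed

lemma a_column:
  assumes "j < n"
  shows "(\<Sum>k<n. a k j) = d"
proof -
  have "{w. (w, vs ! j) \<in> arcs_ends T} \<subseteq> verts T"
    using adj_in_verts(1) by blast
  from sum_indicator[OF this] show ?thesis
    using degree_eulerian_tournament(2)[OF tournament eulerian card_verts nth_vs[OF assms]]
    by (simp add: a_def d_def)
qed

lemma a_symmetric_part:
  assumes "i < n" "j < n"
  shows "a i j + a j i = (if i = j then 0 else 1)"
proof (cases "i = j")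
  case True
  then show ?thesis using adj_not_same[of "vs ! j"] by (auto simp: a_def)
next
  case False
  then have "vs ! i \<noteq> vs ! j"
    using assms distinct_vs by (simp add: n_def nth_eq_iff_index_eq)
  then have "(vs ! i, vs ! j) \<in> arcs_ends T \<longleftrightarrow> (vs ! j, vs ! i) \<notin> arcs_ends T"
    using tournament nth_vs assms unfolding tournament_def by blast
  then show ?thesis
    using False by (simp add: a_def)
qed

lemma L_row: "i < n \<Longrightarrow> (\<Sum>k<n. L i k) = 0"
  by (simp add: L_def sum_subtractf a_row)

lemma L_column: "j < n \<Longrightarrow> (\<Sum>k<n. L k j) = 0"
  by (simp add: L_def sum_subtractf a_column)

lemma c_squared: "c\<^sup>2 * real n = (real n + 1) / 4"
  using n_pos by (simp add: c_def)

lemma det_L_minor: "det (mat (n - 1) (n - 1) (\<lambda>(i, j). L (Suc i) (Suc j))) = real (arb T (vs ! 0))"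
proof -
  obtain v us where vs: "vs = v # us"
    using n_pos by (cases vs) (auto simp: n_def)
  have us: "distinct us" "v \<notin> set us" "set us = verts T - {v}" "insert v (set us) = verts T"
    using distinct_vs set_vs by (auto simp: vs)
  let ?B = "\<lambda>u. {w. (u, w) \<in> arcs_ends T}"
  have len: "n - 1 = length us"
    by (simp add: n_def vs)
  have nth_us: "vs ! Suc i = us ! i" for i
    by (simp add: vs)
  have "det (mat (n - 1) (n - 1) (\<lambda>(i, j). L (Suc i) (Suc j))) =
      det (mat (length us) (length us) (\<lambda>(i, j). (if i = j then real (card (?B (us ! i))) else 0)
      - (if us ! j \<in> ?B (us ! i) then 1 else 0)))"
    unfolding len
  proof (rule det_mat_cong)
    fix i j assume "i < length us" "j < length us"
    then have "real (card (?B (us ! i))) = d"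
      unfolding d_def by (intro degree_eulerian_tournament[OF tournament eulerian card_verts])
        (auto simp: vs simp flip: set_vs)
    then show "L (Suc i) (Suc j) = (if i = j then real (card (?B (us ! i))) else 0)
      - (if us ! j \<in> ?B (us ! i) then 1 else 0)"
      unfolding L_def a_def nth_us by auto
  qed
  also have "\<dots> = real (card {f \<in> PiE (set us) ?B. \<forall>u\<in>set us. \<exists>k. (f ^^ k) u = v})"
    by (rule matrix_tree[OF us(1,2)]) (use us adj_in_verts in blast)
  also have "\<dots> = real (arb T v)"
    using us(4) by (subst arb_eq_card_functions) (auto simp: us(3) digraph_axioms)
  finally show ?thesis by (simp add: vs)
qed

lemma det_L_add_const: "det (mat n n (\<lambda>(i, j). L i j + c)) = c * (real n)\<^sup>2 * real (arb T (vs ! 0))"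
proof -
  obtain m where m: "n = Suc m"
    using n_pos by (cases n) auto
  show ?thesis
    using det_add_const_zero_sums[of m L c] L_row L_column det_L_minor unfolding m by simp
qed

definition X :: "nat \<Rightarrow> nat \<Rightarrow> real" where "X i k = L i k + c"

text \<open>
  Since \<open>A + A\<^sup>T = J - I\<close>, the matrix \<open>X X\<^sup>T\<close> differs from \<open>A A\<^sup>T\<close> only by a linear combination of \<open>I\<close> and \<open>J\<close>. For the
  chosen shift the coefficient of \<open>J\<close> is \<open>- (n - 3) / 4\<close>, the one that the Hadamard equation compensates.
\<close>

lemma dot_rows:
  assumes "i < n" "j < n"
  shows "dot n (X i) (X j) =
    (\<Sum>k<n. a i k * a j k) - (real n - 3) / 4 + (if i = j then q - (real n + 1) / 4 else 0)"
proof -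
  have "dot n (X i) (X j) = (\<Sum>k<n. L i k * L j k) + c * (\<Sum>k<n. L i k) + c * (\<Sum>k<n. L j k) + c\<^sup>2 * real n"
    by (simp add: dot_def X_def algebra_simps sum.distrib sum_distrib_left power2_eq_square)
  also have "\<dots> = (\<Sum>k<n. L i k * L j k) + (real n + 1) / 4"
    using assms by (simp add: L_row c_squared)
  also have "(\<Sum>k<n. L i k * L j k) = (\<Sum>k<n. (if i = k then if i = j then d * d else 0 else 0))
      - (\<Sum>k<n. if i = k then d * a j i else 0) - (\<Sum>k<n. if j = k then d * a i j else 0) + (\<Sum>k<n. a i k * a j k)"
    unfolding sum_subtractf[symmetric] sum.distrib[symmetric]
    by (intro sum.cong) (auto simp: L_def algebra_simps)
  also have "\<dots> = (if i = j then d * d else 0) - d * (a i j + a j i) + (\<Sum>k<n. a i k * a j k)"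
    using assms by (simp add: algebra_simps)
  finally show ?thesis
    unfolding a_symmetric_part[OF assms]
    by (auto simp: d_def q_def field_simps power2_eq_square)
qed

lemma sum_a_a: "i < n \<Longrightarrow> (\<Sum>k<n. a i k * a i k) = d"
  using a_row[of i] by (simp add: a_def if_distrib cong: if_cong)

lemma dot_row_self: "i < n \<Longrightarrow> dot n (X i) (X i) = q"
  by (simp add: dot_rows sum_a_a) (simp add: d_def field_simps)

lemma hadamard_iff: "hadamard_tournament T \<longleftrightarrow> (\<forall>i<n. \<forall>j<n. i \<noteq> j \<longrightarrow> dot n (X i) (X j) = 0)"
proof -
  have entry: "(adjacency_matrix T vs * transpose_mat (adjacency_matrix T vs)) $$ (i, j) = (\<Sum>k<n. a i k * a j k)"
    if "i < n" "j < n" for i j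
    using that by (simp add: adjacency_matrix_def scalar_prod_def n_def a_def atLeast0LessThan)
  have dims: "dim_row (adjacency_matrix T vs) = n"
    by (simp add: adjacency_matrix_def n_def)
  have "hadamard_tournament T \<longleftrightarrow> hadamard_matrix_equation n (adjacency_matrix T vs)"
    using hadamard_tournament_iff[OF distinct_vs set_vs] tournament card_verts by simp
  also have "\<dots> \<longleftrightarrow> (\<forall>i<n. \<forall>j<n. (\<Sum>k<n. a i k * a j k) =
      (if i = j then (real n + 1) / 4 else 0) + (real n - 3) / 4)"
    unfolding hadamard_matrix_equation_def mat_eq_iff
    by (auto simp: dims entry simp del: index_mult_mat(1))
  also have "\<dots> \<longleftrightarrow> (\<forall>i<n. \<forall>j<n. i \<noteq> j \<longrightarrow> dot n (X i) (X j) = 0)"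
  proof (intro iff_allI imp_cong refl)
    fix i j assume "i < n" "j < n"
    then show "(\<Sum>k<n. a i k * a j k) = (if i = j then (real n + 1) / 4 else 0) + (real n - 3) / 4 \<longleftrightarrow>
        (i \<noteq> j \<longrightarrow> dot n (X i) (X j) = 0)"
      by (auto simp: sum_a_a dot_rows d_def field_simps)
  qed
  finally show ?thesis .
qed

lemma det_gram: "det (mat n n (\<lambda>(i, j). dot n (X i) (X j))) = (c * (real n)\<^sup>2 * real (arb T (vs ! 0)))\<^sup>2"
proof -
  let ?X = "mat n n (\<lambda>(i, j). L i j + c)"
  have "mat n n (\<lambda>(i, j). dot n (X i) (X j)) = ?X * transpose_mat ?X"
    by (rule eq_matI) (auto simp: scalar_prod_def dot_def X_def atLeast0LessThan)
  also have "det \<dots> = det ?X * det ?X"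
    by (subst det_mult[of _ n]) (auto simp: det_transpose[of _ n])
  finally show ?thesis
    by (simp add: det_L_add_const power2_eq_square)
qed

lemma q_pos: "q > 0"
  using n_pos by (simp add: q_def)

lemma det_gram_le: "det (mat n n (\<lambda>(i, j). dot n (X i) (X j))) \<le> q ^ n"
  and det_gram_eq_iff: "det (mat n n (\<lambda>(i, j). dot n (X i) (X j))) = q ^ n \<longleftrightarrow> hadamard_tournament T"
proof -
  let ?D = "det (mat n n (\<lambda>(i, j). dot n (X i) (X j)))"
  have prod: "(\<Prod>i<n. dot n (X i) (X i)) = q ^ n"
    by (simp add: dot_row_self)
  show "?D \<le> q ^ n"
    using det_gram_le_prod[of n n X] unfolding prod .
  have "hadamard_tournament T" if "?D = q ^ n"
    unfolding hadamard_iff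
  proof (intro allI impI)
    fix i j assume "i < n" "j < n" "i \<noteq> j"
    then show "dot n (X i) (X j) = 0"
      by (intro orthogonal_if_det_gram_eq_prod[of n n X]) (use that prod q_pos dot_row_self in simp_all)
  qed
  moreover have "?D = q ^ n" if "hadamard_tournament T"
  proof -
    have "mat n n (\<lambda>(i, j). dot n (X i) (X j)) = q \<cdot>\<^sub>m 1\<^sub>m n"
      using that unfolding hadamard_iff by (intro eq_matI) (simp_all add: dot_row_self)
    then show ?thesis by simp
  qed
  ultimately show "?D = q ^ n \<longleftrightarrow> hadamard_tournament T"
    by blast
qed

text \<open>
  By \<open>det X = c n\<^sup>2 arb\<close> and \<open>c\<^sup>2 n\<^sup>2 = q\<close>, the Gram determinant is \<open>q (n arb)\<^sup>2\<close>. The bound is kept in squared form because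
  the exponent \<open>(n - 1) / 2\<close> becomes natural that way.
\<close>

lemma arb_bound_squared:
  "(real n * real (arb T (vs ! 0)))\<^sup>2 \<le> q ^ (n - 1)"
  "(real n * real (arb T (vs ! 0)))\<^sup>2 = q ^ (n - 1) \<longleftrightarrow> hadamard_tournament T"
proof -
  define b where "b = real n * real (arb T (vs ! 0))"
  have "det (mat n n (\<lambda>(i, j). dot n (X i) (X j))) = (c\<^sup>2 * real n) * real n * b\<^sup>2"
    unfolding det_gram b_def by (simp add: power2_eq_square)
  also have "\<dots> = q * b\<^sup>2"
    unfolding c_squared by (simp add: q_def)
  finally have det: "det (mat n n (\<lambda>(i, j). dot n (X i) (X j))) = q * b\<^sup>2" .
  have pow: "q ^ n = q * q ^ (n - 1)"
    using n_pos by (cases n) auto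
  have "q * b\<^sup>2 \<le> q * q ^ (n - 1)"
    using det_gram_le unfolding det pow .
  then show "(real n * real (arb T (vs ! 0)))\<^sup>2 \<le> q ^ (n - 1)"
    using q_pos unfolding b_def[symmetric] by (rule mult_left_le_imp_le)
  have "q * b\<^sup>2 = q * q ^ (n - 1) \<longleftrightarrow> hadamard_tournament T"
    using det_gram_eq_iff unfolding det pow .
  moreover have "q * b\<^sup>2 = q * q ^ (n - 1) \<longleftrightarrow> b\<^sup>2 = q ^ (n - 1)"
    using q_pos by (metis less_irrefl mult_left_cancel)
  ultimately show "(real n * real (arb T (vs ! 0)))\<^sup>2 = q ^ (n - 1) \<longleftrightarrow> hadamard_tournament T"
    unfolding b_def by blast
qed

end

section \<open>The extremal theorem\<close>

theorem theorem1p11: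
  fixes T :: "('a, 'b) pre_digraph" and v :: 'a and n :: nat
  assumes "tournament T"
    and "eulerian T"
    and "card (verts T) = n"
    and "v \<in> verts T"
  shows "real (arb T v) \<le> 1 / real n * (real n * (real n + 1) / 4) powr ((real n - 1) / 2) \<and>
    (real (arb T v) = 1 / real n * (real n * (real n + 1) / 4) powr ((real n - 1) / 2)
       \<longleftrightarrow> hadamard_tournament T)"
proof -
  interpret digraph T
    using assms(1) by (simp add: tournament_def)
  obtain us where us: "set us = verts T - {v}" "distinct us"
    using finite_distinct_list[of "verts T - {v}"] by auto
  define vs where "vs = v # us"
  have vs: "distinct vs" "set vs = verts T"
    using us assms(4) by (auto simp: vs_def)
  have len: "n = length vs"
    using distinct_card[OF vs(1)] assms(3) vs(2) by simp
  have n_pos: "n > 0"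
    by (simp add: len vs_def)
  interpret E: enumerated_eulerian_tournament T vs n
    using assms(1,2) vs len n_pos by (intro enumerated_eulerian_tournament.intro)
  define r where "r = E.q powr ((real n - 1) / 2)"
  define b where "b = real n * real (arb T v)"
  have "r\<^sup>2 = E.q powr (real n - 1)"
    by (simp add: r_def power2_eq_square flip: powr_add)
  also have "\<dots> = E.q powr real (n - 1)"
    using n_pos by (simp add: of_nat_diff)
  also have "\<dots> = E.q ^ (n - 1)"
    using E.q_pos by (rule powr_realpow)
  finally have r_squared: "r\<^sup>2 = E.q ^ (n - 1)" .
  have nonneg: "r \<ge> 0" "b \<ge> 0"
    by (simp_all add: r_def b_def)
  have root: "vs ! 0 = v"
    by (simp add: vs_def)
  have "b\<^sup>2 \<le> r\<^sup>2"
    using E.arb_bound_squared(1) unfolding root r_squared b_def .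
  then have le: "b \<le> r"
    using nonneg(1) by (rule power2_le_imp_le)
  have "b\<^sup>2 = r\<^sup>2 \<longleftrightarrow> hadamard_tournament T"
    using E.arb_bound_squared(2) unfolding root r_squared b_def .
  then have eq: "b = r \<longleftrightarrow> hadamard_tournament T"
    using power2_eq_iff_nonneg[OF nonneg(2,1)] by blast
  have arb: "real (arb T v) = 1 / real n * b"
    using n_pos by (simp add: b_def)
  have "1 / real n * b \<le> 1 / real n * r"
    using le by (intro mult_left_mono) simp_all
  moreover have "1 / real n * b = 1 / real n * r \<longleftrightarrow> b = r"
    using n_pos by simp
  ultimately show ?thesis
    using eq unfolding arb r_def E.q_def by blast
qed

end
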